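(* Let $\Omega\subset\mathbb{R}^N$ be an open set, $N=N_1+\dots+N_k\ge3$, and let $\lambda=(\lambda_1,\dots,\lambda_k)$, $\sigma_i$ and $\nabla_\lambda$ be as in the context. Let $\|\cdot\|_\lambda$ be either of the two homogeneous norms $$\|x\|_\lambda=\left(\sum_{j=1}^k|x^{(j)}|^{2\prod_{i\ne j}\sigma_i}\right)^{\frac{1}{2\prod_{i=1}^k\sigma_i}}\quad\text{or}\quad\|x\|_\lambda=\left(\sum_{j=1}^k(\sigma_j|x^{(j)}|)^{2\prod_{i\ne j}\sigma_i}\right)^{\frac{1}{2\prod_{i=1}^k\sigma_i}}.$$ Let $N_1>p>1$. Then for every $u\in\mathring{W}_\lambda^{1,p}(\Omega)$, $$\left(\frac{N_1-p}{p}\right)^p\int_\Omega\frac{|u(x)|^p}{|x^{(1)}|^p}\,dx\le\int_\Omega|\nabla_\lambda u(x)|^p\,dx$$ and $$\left(\frac{N_1-p}{p}\right)^p\int_\Omega\frac{|u(x)|^p}{\|x\|_\lambda^p}\,dx\le\int_\Omega|\nabla_\lambda u(x)|^p\,dx.$$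
   Context: Split $\mathbb{R}^N=\mathbb{R}^{N_1}\times\dots\times\mathbb{R}^{N_k}$ and write $x=(x^{(1)},\dots,x^{(k)})$ with $x^{(i)}=(x^{(i)}_1,\dots,x^{(i)}_{N_i})\in\mathbb{R}^{N_i}$; $|\cdot|$ is the Euclidean norm. Let $\alpha_{ij}\ge 0$ for $1\le j<i\le k$ be real constants and set $\alpha_{ij}=0$ for $j\ge i$. Define $$\lambda_i(x)=\prod_{j=1}^k|x^{(j)}|^{\alpha_{ij}},\qquad i=1,\dots,k,$$ so $\lambda_1\equiv1$; the functions $\lambda_i$ are assumed pairwise different. Define $\sigma_1=1$ and $\sigma_i=1+\sum_{j=1}^{i-1}\alpha_{ij}\sigma_j$ for $i=2,\dots,k$. For a $C^1$ function $u$, $\nabla_\lambda u=(\lambda_1\nabla_{x^{(1)}}u,\dots,\lambda_k\nabla_{x^{(k)}}u)$, where $\nabla_{x^{(i)}}$ is the gradient in the variables $x^{(i)}$. $\mathring{W}_\lambda^{1,p}(\Omega)$ denotes the closure of $C_0^1(\Omega)$ (compactly supported $C^1$ functions on $\Omega$) with respect to the norm $\left(\int_\Omega|\nabla_\lambda u(x)|^p\,dx\right)^{1/p}$. *)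

theory Defs
  imports "HOL-Analysis.Analysis"
begin

text \<open>
  The space \<open>R^N = R^(N_1) \<times> \<dots> \<times> R^(N_k)\<close> is \<open>real ^ 'n\<close> together with a map
  \<open>blk :: 'n \<Rightarrow> nat\<close> whose range is \<open>{1..k}\<close>: the coordinate \<open>m\<close> belongs to the factor
  with number \<open>blk m\<close>.
\<close>

definition bdim :: "('n::finite \<Rightarrow> nat) \<Rightarrow> nat \<Rightarrow> nat" where
  "bdim blk i = card {m. blk m = i}"

text \<open>The component \<open>x^(i)\<close>, embedded into the whole space (which does not change its norm).\<close>

definition bcomp :: "('n::finite \<Rightarrow> nat) \<Rightarrow> nat \<Rightarrow> real ^ 'n \<Rightarrow> real ^ 'n" where
  "bcomp blk i x = (\<chi> m. if blk m = i then x $ m else 0)"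

text \<open>Powers with \<open>t^0 = 1\<close> also at \<open>t = 0\<close>, whereas \<open>0 powr 0 = 0\<close> in the library.\<close>

definition rpow :: "real \<Rightarrow> real \<Rightarrow> real" where
  "rpow t a = (if a = 0 then 1 else t powr a)"

definition lam ::
  "('n::finite \<Rightarrow> nat) \<Rightarrow> nat \<Rightarrow> (nat \<Rightarrow> nat \<Rightarrow> real) \<Rightarrow> nat \<Rightarrow> real ^ 'n \<Rightarrow> real" where
  "lam blk k \<alpha> i x = (\<Prod>j\<in>{1..k}. rpow (norm (bcomp blk j x)) (\<alpha> i j))"

function sigma :: "(nat \<Rightarrow> nat \<Rightarrow> real) \<Rightarrow> nat \<Rightarrow> real" where
  "sigma \<alpha> i = 1 + (\<Sum>j\<in>{1..<i}. \<alpha> i j * sigma \<alpha> j)"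
  by pat_completeness auto
termination by (relation "Wellfounded.measure snd") auto

declare sigma.simps [simp del]

definition hnorm ::
  "('n::finite \<Rightarrow> nat) \<Rightarrow> nat \<Rightarrow> (nat \<Rightarrow> nat \<Rightarrow> real) \<Rightarrow> real ^ 'n \<Rightarrow> real" where
  "hnorm blk k \<alpha> x =
     (\<Sum>j\<in>{1..k}. norm (bcomp blk j x) powr (2 * (\<Prod>i\<in>{1..k} - {j}. sigma \<alpha> i)))
       powr (1 / (2 * (\<Prod>i\<in>{1..k}. sigma \<alpha> i)))"

definition hnorm_weighted ::
  "('n::finite \<Rightarrow> nat) \<Rightarrow> nat \<Rightarrow> (nat \<Rightarrow> nat \<Rightarrow> real) \<Rightarrow> real ^ 'n \<Rightarrow> real" where
  "hnorm_weighted blk k \<alpha> x =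
     (\<Sum>j\<in>{1..k}. (sigma \<alpha> j * norm (bcomp blk j x))
                      powr (2 * (\<Prod>i\<in>{1..k} - {j}. sigma \<alpha> i)))
       powr (1 / (2 * (\<Prod>i\<in>{1..k}. sigma \<alpha> i)))"

definition pderivative :: "'n::finite \<Rightarrow> (real ^ 'n \<Rightarrow> real) \<Rightarrow> real ^ 'n \<Rightarrow> real" where
  "pderivative m \<phi> x = frechet_derivative \<phi> (at x) (axis m 1)"

definition lam_gradient ::
  "('n::finite \<Rightarrow> nat) \<Rightarrow> nat \<Rightarrow> (nat \<Rightarrow> nat \<Rightarrow> real) \<Rightarrow>
   (real ^ 'n \<Rightarrow> real) \<Rightarrow> real ^ 'n \<Rightarrow> real ^ 'n" where
  "lam_gradient blk k \<alpha> \<phi> x = (\<chi> m. lam blk k \<alpha> (blk m) x * pderivative m \<phi> x)"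

text \<open>\<open>C_0^1(\<Omega>)\<close>, its elements being extended by zero to the whole space.\<close>

definition C01 :: "(real ^ 'n::finite) set \<Rightarrow> (real ^ 'n \<Rightarrow> real) set" where
  "C01 \<Omega> = {\<phi>. \<phi> differentiable_on UNIV \<and>
                (\<forall>m. continuous_on UNIV (pderivative m \<phi>)) \<and>
                compact (closure {x. \<phi> x \<noteq> 0}) \<and> closure {x. \<phi> x \<noteq> 0} \<subseteq> \<Omega>}"

definition Lp_norm ::
  "real \<Rightarrow> (real ^ 'n::finite) set \<Rightarrow> (real ^ 'n \<Rightarrow> real ^ 'n) \<Rightarrow> ennreal" where
  "Lp_norm p \<Omega> F =
     (let I = (\<integral>\<^sup>+x. ennreal (norm (F x) powr p) \<partial>lebesgue_on \<Omega>)
      in if I = \<infinity> then \<infinity> else ennreal (enn2real I powr (1 / p)))"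

text \<open>
  The closure of \<open>C_0^1(\<Omega>)\<close> in the norm \<open>\<phi> \<mapsto> Lp_norm p \<Omega> (lam_gradient \<phi>)\<close>. The gradient
  of a limit function is obtained by continuous extension, so the closure is described by the
  relation ``\<open>u\<close> belongs to the closure and \<open>G\<close> is its gradient'': some sequence in \<open>C_0^1(\<Omega>)\<close>
  has gradients converging to \<open>G\<close> in \<open>L^p(\<Omega>)\<close> and itself converges to \<open>u\<close> in \<open>L^1_loc(\<Omega>)\<close>.
  The second condition says which function is the limit; the norm alone does not see additive
  constants. For \<open>1 < p < N_1\<close> it is no restriction, since by Hardy's inequality in the variables
  \<open>x^(1)\<close> every Cauchy sequence for the norm converges in \<open>L^p\<close> on bounded sets.
\<close>

definition has_lam_gradient ::
  "('n::finite \<Rightarrow> nat) \<Rightarrow> nat \<Rightarrow> (nat \<Rightarrow> nat \<Rightarrow> real) \<Rightarrow> real \<Rightarrow> (real ^ 'n) set \<Rightarrow>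
   (real ^ 'n \<Rightarrow> real) \<Rightarrow> (real ^ 'n \<Rightarrow> real ^ 'n) \<Rightarrow> bool" where
  "has_lam_gradient blk k \<alpha> p \<Omega> u G \<longleftrightarrow>
     u \<in> borel_measurable (lebesgue_on \<Omega>) \<and>
     G \<in> borel_measurable (lebesgue_on \<Omega>) \<and>
     (\<exists>\<phi> :: nat \<Rightarrow> real ^ 'n \<Rightarrow> real.
        (\<forall>n. \<phi> n \<in> C01 \<Omega>) \<and>
        (\<lambda>n. Lp_norm p \<Omega> (\<lambda>x. lam_gradient blk k \<alpha> (\<phi> n) x - G x)) \<longlonglongrightarrow> 0 \<and>
        (\<forall>K. compact K \<and> K \<subseteq> \<Omega> \<longrightarrow>
           (\<lambda>n. \<integral>\<^sup>+x. ennreal \<bar>\<phi> n x - u x\<bar> \<partial>lebesgue_on K) \<longlonglongrightarrow> 0))"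

definition W0 ::
  "('n::finite \<Rightarrow> nat) \<Rightarrow> nat \<Rightarrow> (nat \<Rightarrow> nat \<Rightarrow> real) \<Rightarrow> real \<Rightarrow> (real ^ 'n) set \<Rightarrow>
   (real ^ 'n \<Rightarrow> real) set" where
  "W0 blk k \<alpha> p \<Omega> = {u. \<exists>G. has_lam_gradient blk k \<alpha> p \<Omega> u G}"

lemma lam_1:
  assumes "\<And>j. j \<in> {1..k} \<Longrightarrow> \<alpha> 1 j = 0"
  shows "lam blk k \<alpha> 1 x = 1"
  using assms by (simp add: lam_def rpow_def)

lemma sigma_1: "sigma \<alpha> 1 = 1"
  by (subst sigma.simps) simp

lemma borel_measurable_lam: "lam blk k \<alpha> i \<in> borel_measurable borel"
proof -
  have "(\<lambda>x. rpow (norm (bcomp blk j x)) (\<alpha> i j)) \<in> borel_measurable borel" for j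
  proof -
    have "linear (bcomp blk j)"
      by (rule linearI) (auto simp: bcomp_def vec_eq_iff)
    then have "bcomp blk j \<in> borel_measurable borel"
      by (intro borel_measurable_continuous_onI linear_continuous_on)
         (simp add: linear_conv_bounded_linear)
    then show ?thesis
      by (cases "\<alpha> i j = 0") (simp_all add: rpow_def)
  qed
  then show ?thesis
    unfolding lam_def[abs_def] by measurable
qed

lemma has_lam_gradient_C01:
  assumes "\<phi> \<in> C01 \<Omega>" "open \<Omega>"
  shows "has_lam_gradient blk k \<alpha> p \<Omega> \<phi> (lam_gradient blk k \<alpha> \<phi>)"
proof -
  have \<phi>: "\<phi> \<in> borel_measurable borel"
    using assms(1)
    by (auto simp: C01_def intro!: borel_measurable_continuous_onI differentiable_imp_continuous_on)
  have "pderivative m \<phi> \<in> borel_measurable borel" for m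
    using assms(1) by (auto simp: C01_def intro!: borel_measurable_continuous_onI)
  then have "(\<lambda>x. lam_gradient blk k \<alpha> \<phi> x \<bullet> b) \<in> borel_measurable borel" if "b \<in> Basis" for b
    using that borel_measurable_lam
    by (auto simp: Basis_vec_def inner_axis lam_gradient_def intro!: borel_measurable_times)
  then have G: "lam_gradient blk k \<alpha> \<phi> \<in> borel_measurable borel"
    by (subst borel_measurable_euclidean_space) auto
  have *: "f \<in> borel_measurable (lebesgue_on \<Omega>)"
    if "f \<in> borel_measurable borel" for f :: "real ^ 'a \<Rightarrow> 'c::topological_space"
    using that by (intro measurable_restrict_space1 measurable_completion) simp
  show ?thesis
    unfolding has_lam_gradient_def using assms(1)
    by (auto intro!: *[OF \<phi>] *[OF G] exI[of _ "\<lambda>n. \<phi>"] simp: Lp_norm_def)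
qed

end

theory Submission
  imports Defs
begin

text \<open>
  The second inequality follows from the first since \<open>|x^(1)| \<le> \<parallel>x\<parallel>_\<lambda>\<close>. The first one rests on
  the dilations \<open>D_s\<close>, which multiply \<open>x^(1)\<close> by \<open>e^s\<close> and fix the other variables.
  Let \<open>d = (N_1 - p)/p\<close> and let \<open>\<phi>\<close> be in \<open>C_0^1\<close>. Integrating the derivative of
  \<open>e^((p-1)ds) |\<phi>(D_s x)|^p\<close> over \<open>s \<ge> 0\<close> and estimating it by Young's inequality bounds
  \<open>|\<phi>(x)|^p / |x^(1)|^p\<close> by \<open>d^(1-p)\<close> times the integral over \<open>s \<ge> 0\<close> of
  \<open>e^((p-1)ds + ps) |\<nabla>_1 \<phi>(D_s x)|^p\<close>. By Tonelli's theorem and the substitution \<open>D_s\<close> in \<open>x\<close>,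
  whose Jacobian is \<open>e^(s N_1)\<close>, the integral over \<open>x\<close> is \<open>d^(-p)\<close> times that of
  \<open>|\<nabla>_1 \<phi>|^p\<close>; and \<open>|\<nabla>_1 \<phi>| \<le> |\<nabla>_\<lambda> \<phi>|\<close> because \<open>\<lambda>_1 = 1\<close>. The general
  case follows by Fatou's lemma along an almost everywhere convergent subsequence on each compact
  subset of \<open>\<Omega>\<close>.
\<close>

section \<open>A one-dimensional estimate with exponential weight\<close>

lemma DERIV_abs_powr:
  fixes p y :: real
  assumes "1 < p"
  shows "((\<lambda>y. \<bar>y\<bar> powr p) has_real_derivative p * \<bar>y\<bar> powr (p - 1) * sgn y) (at y)"
proof (cases "y = 0")
  case True
  \<comment> \<open>At the origin the difference quotient has modulus
    \<open>\<bar>h\<bar> powr (p - 1)\<close>, which tends to 0 because p > 1.\<close>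
  have "((\<lambda>h. \<bar>h\<bar> powr (p - 1)) \<longlongrightarrow> \<bar>0::real\<bar> powr (p - 1)) (at (0::real))"
    using assms by (intro tendsto_powr2 tendsto_intros) auto
  then have "((\<lambda>h. \<bar>h\<bar> powr (p - 1)) \<longlongrightarrow> 0) (at (0::real))"
    using assms by simp
  moreover have "\<bar>\<bar>h\<bar> powr p / h\<bar> = \<bar>h\<bar> powr (p - 1)" if "h \<noteq> 0" for h :: real
    using that by (simp add: powr_diff)
  ultimately have *: "((\<lambda>h. \<bar>\<bar>h\<bar> powr p / h\<bar>) \<longlongrightarrow> 0) (at (0::real))"
    by (subst tendsto_cong[where g = "\<lambda>h. \<bar>h\<bar> powr (p - 1)"])
       (auto simp: eventually_at_filter)
  then show ?thesis
    using True tendsto_rabs_zero_cancel[OF *] by (simp add: DERIV_def)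
next
  case False
  \<comment> \<open>On the open half-line containing y the sign is constant, so |z| =
    \<open>sgn y * z\<close> there and the ordinary power rule applies.\<close>
  have "((\<lambda>z. (sgn y * z) powr p) has_real_derivative p * \<bar>y\<bar> powr (p - 1) * sgn y) (at y)"
    using False
    by (auto intro!: derivative_eq_intros simp: sgn_if powr_diff zero_less_mult_iff)
  then show ?thesis
    by (rule has_field_derivative_transform_within_open[where S = "{z. 0 < sgn y * z}"])
       (use False in \<open>auto simp: sgn_if intro!: open_Collect_less continuous_intros split: if_splits\<close>)
qed

text \<open>Young's inequality with exponents p and p/(p - 1), where d shifts weight between the two
  terms. The coefficient \<open>(p - 1) * d\<close> is the one that differentiating
  \<open>exp ((p - 1) * d * s)\<close> produces, so that the two cancel in the next lemma.\<close>

lemma Youngs_inequality_scaled: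
  fixes a b d p :: real
  assumes "1 < p" "0 < d" "0 \<le> a" "0 \<le> b"
  shows "p * a powr (p - 1) * b \<le> (p - 1) * d * a powr p + d powr (1 - p) * b powr p"
proof -
  define q where "q = p / (p - 1)"
  \<comment> \<open>The powers of d in \<open>x\<close> and \<open>y\<close> are reciprocal: they
    cancel in \<open>y * x\<close> and become d and \<open>d powr (1 - p)\<close> in
    \<open>x powr q\<close> and \<open>y powr p\<close>.\<close>
  define x where "x = d powr ((p - 1) / p) * a powr (p - 1)"
  define y where "y = d powr (- ((p - 1) / p)) * b"
  have "y * x \<le> y powr p / p + x powr q / q"
    using assms by (intro Youngs_inequality) (auto simp: q_def x_def y_def field_simps)
  moreover have "y * x = a powr (p - 1) * b"
    using assms by (simp add: x_def y_def powr_minus)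
  moreover have "y powr p = d powr (1 - p) * b powr p"
    using assms by (simp add: y_def powr_mult powr_powr)
  moreover have "x powr q = d * a powr p"
    using assms by (simp add: x_def q_def powr_mult powr_powr)
  ultimately have "a powr (p - 1) * b \<le> d powr (1 - p) * b powr p / p + d * a powr p * (p - 1) / p"
    by (simp add: q_def)
  then have "p * (a powr (p - 1) * b)
      \<le> p * (d powr (1 - p) * b powr p / p + d * a powr p * (p - 1) / p)"
    using assms by (intro mult_left_mono) auto
  also have "\<dots> = (p - 1) * d * a powr p + d powr (1 - p) * b powr p"
    using assms by (simp add: field_simps)
  finally show ?thesis by (simp add: mult.assoc)
qed

text \<open>The weighted power \<open>H\<close> of |f| decreases at most at the rate
  \<open>R\<close>, by Young's inequality, and vanishes at T, so its value at 0 is at most the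
  integral of \<open>R\<close>. Using the continuous majorant g in place of |f'| gives
  \<open>R\<close> an antiderivative.\<close>

lemma abs_powr_le_exp_weighted_nn_integral:
  fixes f f' g :: "real \<Rightarrow> real"
  assumes p: "1 < p" and d: "0 < d" and T: "0 \<le> T" "f T = 0"
    and f: "\<And>s. (f has_real_derivative f' s) (at s)"
    and g: "continuous_on UNIV g" "\<And>s. \<bar>f' s\<bar> \<le> g s"
  shows "ennreal (\<bar>f 0\<bar> powr p)
    \<le> (\<integral>\<^sup>+s. ennreal (d powr (1 - p) * exp ((p - 1) * d * s) * g s powr p) * indicator {0..} s \<partial>lborel)"
proof -
  define R where "R s = d powr (1 - p) * exp ((p - 1) * d * s) * g s powr p" for s
  have g0: "0 \<le> g s" for s
    using g(2)[of s] by linarith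
  have R: "continuous_on UNIV R" "\<And>s. 0 \<le> R s"
    using p g(1) g0 by (auto simp: R_def intro!: continuous_intros continuous_on_powr')
  \<comment> \<open>The interval exceeds [0, T] on both sides, so that \<open>J\<close> has
    two-sided derivatives at 0 and T as well.\<close>
  obtain J where J: "\<And>s. s \<in> {-1..T + 1} \<Longrightarrow> (J has_vector_derivative R s) (at s within {-1..T + 1})"
    using antiderivative_continuous[OF continuous_on_subset[OF R(1)]] by (metis subset_UNIV)
  have J': "(J has_real_derivative R s) (at s)" if "0 \<le> s" "s \<le> T" for s
    using J[of s] that
    by (simp add: has_real_derivative_iff_has_vector_derivative at_within_Icc_at)
  define H where "H s = exp ((p - 1) * d * s) * \<bar>f s\<bar> powr p" for s
  define H' where "H' s = exp ((p - 1) * d * s) *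
      ((p - 1) * d * \<bar>f s\<bar> powr p + p * \<bar>f s\<bar> powr (p - 1) * sgn (f s) * f' s)" for s
  have H: "(H has_real_derivative H' s) (at s)" for s
    unfolding H_def H'_def
    by (rule derivative_eq_intros DERIV_chain2[OF DERIV_abs_powr[OF p]] f refl)+
       (simp add: algebra_simps)
  \<comment> \<open>The term with f' is at least -p |f|^(p-1) g. Of Young's bound for p |f|^(p-1) g,
    the first part is absorbed by the derivative of the exponential weight and the second is
    \<open>R\<close>.\<close>
  have "0 \<le> H' s + R s" for s
  proof -
    have "- (p * \<bar>f s\<bar> powr (p - 1) * sgn (f s) * f' s) \<le> p * \<bar>f s\<bar> powr (p - 1) * g s"
    proof -
      have "- (sgn (f s) * f' s) \<le> g s"
        using g(2)[of s] g0[of s] by (auto simp: sgn_if)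
      then have "p * \<bar>f s\<bar> powr (p - 1) * (- (sgn (f s) * f' s)) \<le> p * \<bar>f s\<bar> powr (p - 1) * g s"
        using p by (intro mult_left_mono) auto
      then show ?thesis by (simp add: mult.assoc)
    qed
    also have "\<dots> \<le> (p - 1) * d * \<bar>f s\<bar> powr p + d powr (1 - p) * g s powr p"
      using Youngs_inequality_scaled[OF p d, of "\<bar>f s\<bar>" "g s"] g0 by simp
    finally have "0 \<le> exp ((p - 1) * d * s) * ((p - 1) * d * \<bar>f s\<bar> powr p + 
        p * \<bar>f s\<bar> powr (p - 1) * sgn (f s) * f' s + d powr (1 - p) * g s powr p)"
      by (intro mult_nonneg_nonneg) auto
    then show ?thesis
      by (simp add: H'_def R_def algebra_simps)
  qed
  then have "H 0 + J 0 \<le> H T + J T"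
    using T by (intro DERIV_nonneg_imp_nondecreasing[where f = "\<lambda>s. H s + J s"])
      (auto intro!: exI conjI DERIV_add H J')
  then have "\<bar>f 0\<bar> powr p \<le> J T - J 0"
    using T p by (simp add: H_def)
  then have "ennreal (\<bar>f 0\<bar> powr p) \<le> ennreal (J T - J 0)"
    by (rule ennreal_leI)
  also have "\<dots> = (\<integral>\<^sup>+s. ennreal (R s) * indicator {0..T} s \<partial>lborel)"
    using R T J' by (intro nn_integral_FTC_Icc[symmetric])
      (auto intro!: borel_measurable_continuous_onI)
  also have "\<dots> \<le> (\<integral>\<^sup>+s. ennreal (R s) * indicator {0..} s \<partial>lborel)"
    by (intro nn_integral_mono) (auto simp: indicator_def)
  finally show ?thesis by (simp add: R_def)
qed

section \<open>Dilations of one block of variables\<close>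

definition block_dilation :: "('n::finite \<Rightarrow> nat) \<Rightarrow> nat \<Rightarrow> real \<Rightarrow> real ^ 'n \<Rightarrow> real ^ 'n" where
  "block_dilation blk i s x = (\<chi> m. if blk m = i then exp s * x $ m else x $ m)"

text \<open>This is the gradient in the variables x^(i), padded with zeros as in
  \<open>bcomp\<close>, which does not change its norm.\<close>

definition block_gradient :: "('n::finite \<Rightarrow> nat) \<Rightarrow> nat \<Rightarrow> (real ^ 'n \<Rightarrow> real) \<Rightarrow> real ^ 'n \<Rightarrow> real ^ 'n" where
  "block_gradient blk i \<phi> x = bcomp blk i (\<chi> m. pderivative m \<phi> x)"

lemma block_dilation_0 [simp]: "block_dilation blk i 0 x = x"
  by (simp add: block_dilation_def vec_eq_iff)

lemma bcomp_block_dilation: "bcomp blk i (block_dilation blk i s x) = exp s *\<^sub>R bcomp blk i x"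
  by (simp add: bcomp_def block_dilation_def vec_eq_iff)

lemma norm_bcomp_le: "norm (bcomp blk i x) \<le> norm x"
  by (rule norm_le_componentwise_cart) (simp add: bcomp_def)

lemma continuous_on_bcomp [continuous_intros]:
  assumes "continuous_on S f"
  shows "continuous_on S (\<lambda>x. bcomp blk i (f x))"
  unfolding bcomp_def
  by (rule continuous_on_vec_lambda, rename_tac m, case_tac "blk m = i") (auto intro!: continuous_intros assms)

lemma continuous_on_block_dilation [continuous_intros]:
  assumes "continuous_on S f" "continuous_on S g"
  shows "continuous_on S (\<lambda>x. block_dilation blk i (f x) (g x))"
  unfolding block_dilation_def
  by (rule continuous_on_vec_lambda, rename_tac m, case_tac "blk m = i") (auto intro!: continuous_intros assms)

text \<open>A moving coordinate is a constant times \<open>exp s\<close> and hence its own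
  derivative, while the others are constant. The velocity is therefore the Euler field of block i,
  and along these curves only the gradient in x^(i) enters the chain rule.\<close>

lemma has_vector_derivative_block_dilation:
  "((\<lambda>s. block_dilation blk i s x) has_vector_derivative bcomp blk i (block_dilation blk i s x)) (at s)"
proof -
  have "((\<lambda>s. block_dilation blk i s x $ m) has_vector_derivative bcomp blk i (block_dilation blk i s x) $ m) (at s)"
    for m
    unfolding has_real_derivative_iff_has_vector_derivative[symmetric]
    by (cases "blk m = i") (auto simp: block_dilation_def bcomp_def intro!: derivative_eq_intros)
  then show ?thesis
    unfolding has_vector_derivative_def
    by (subst has_derivative_componentwise_within) (auto simp: Basis_vec_def inner_axis)
qed

lemma frechet_derivative_eq_sum_pderivative:
  fixes \<phi> :: "real ^ 'n::finite \<Rightarrow> real"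
  assumes "\<phi> differentiable at x"
  shows "frechet_derivative \<phi> (at x) v = (\<Sum>m\<in>UNIV. v $ m * pderivative m \<phi> x)"
proof -
  have lin: "linear (frechet_derivative \<phi> (at x))"
    using assms by (rule linear_frechet_derivative)
  have "frechet_derivative \<phi> (at x) v = frechet_derivative \<phi> (at x) (\<Sum>m\<in>UNIV. v $ m *s axis m 1)"
    by (simp add: basis_expansion)
  also have "\<dots> = (\<Sum>m\<in>UNIV. v $ m * pderivative m \<phi> x)"
    by (simp add: linear_sum[OF lin] linear_cmul[OF lin] scalar_mult_eq_scaleR pderivative_def)
  finally show ?thesis .
qed

text \<open>The direction has no coordinates outside block i, so the derivative is an inner product
  with \<open>block_gradient\<close> and Cauchy-Schwarz applies.\<close>

lemma frechet_derivative_bcomp_le: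
  fixes \<phi> :: "real ^ 'n::finite \<Rightarrow> real"
  assumes "\<phi> differentiable at x"
  shows "\<bar>frechet_derivative \<phi> (at x) (bcomp blk i v)\<bar> \<le> norm (bcomp blk i v) * norm (block_gradient blk i \<phi> x)"
proof -
  have "frechet_derivative \<phi> (at x) (bcomp blk i v) = bcomp blk i v \<bullet> block_gradient blk i \<phi> x"
    by (auto simp: frechet_derivative_eq_sum_pderivative[OF assms] inner_vec_def
        block_gradient_def bcomp_def intro!: sum.cong)
  then show ?thesis
    using Cauchy_Schwarz_ineq2 by metis
qed

text \<open>The dilation is diagonal with N_i entries e^s and all others 1, so the substitution
  divides by its determinant e^(s N_i).\<close>

lemma nn_integral_block_dilation:
  fixes blk :: "'n::finite \<Rightarrow> nat" and F :: "real ^ 'n \<Rightarrow> ennreal"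
  assumes [measurable]: "F \<in> borel_measurable borel"
  shows "(\<integral>\<^sup>+x. F (block_dilation blk i s x) \<partial>lborel)
    = ennreal (exp (- s * real (bdim blk i))) * (\<integral>\<^sup>+x. F x \<partial>lborel)"
proof -
  \<comment> \<open>\<open>lborel_affine_euclidean\<close> takes its scaling factors indexed by
    basis vectors, so the factor of coordinate m is attached to \<open>axis m 1\<close>.\<close>
  define c where "c b = (if \<exists>m. blk m = i \<and> b = axis m 1 then exp s else 1)" for b :: "real ^ 'n"
  have B: "(Basis :: (real ^ 'n) set) = range (\<lambda>m. axis m 1)"
    by (auto simp: Basis_vec_def)
  have inj: "inj (\<lambda>m::'n. axis m (1::real))"
    by (auto simp: inj_on_def axis_eq_axis)
  have c_axis: "c (axis m 1) = (if blk m = i then exp s else 1)" for m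
    by (auto simp: c_def axis_eq_axis)
  have T: "0 + (\<Sum>b\<in>Basis. (c b * (x \<bullet> b)) *\<^sub>R b) = block_dilation blk i s x" for x
  proof -
    have "(\<Sum>b\<in>Basis. (c b * (x \<bullet> b)) *\<^sub>R b)
        = (\<Sum>m\<in>UNIV. ((if blk m = i then exp s else 1) * x $ m) *\<^sub>R axis m 1)"
      unfolding B by (subst sum.reindex[OF inj]) (simp add: c_axis inner_axis)
    also have "\<dots> = block_dilation blk i s x"
      by (simp add: vec_eq_iff block_dilation_def axis_def if_distrib cong: if_cong)
    finally show ?thesis by simp
  qed
  have prod: "(\<Prod>b\<in>Basis. \<bar>c b\<bar>) = exp (s * real (bdim blk i))"
  proof -
    have "(\<Prod>b\<in>Basis. \<bar>c b\<bar>) = (\<Prod>m\<in>UNIV. if blk m = i then exp s else 1)"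
      unfolding B by (subst prod.reindex[OF inj]) (auto simp: c_axis intro!: prod.cong)
    also have "\<dots> = exp s ^ bdim blk i"
      by (simp add: prod.If_cases bdim_def)
    finally show ?thesis
      by (simp add: exp_of_nat_mult[symmetric] mult.commute)
  qed
  have [measurable]: "block_dilation blk i s \<in> borel_measurable borel"
    by (intro borel_measurable_continuous_onI continuous_intros)
  have "(\<integral>\<^sup>+x. F x \<partial>lborel)
      = (\<integral>\<^sup>+x. F x \<partial>density (distr lborel borel (block_dilation blk i s)) (\<lambda>_. ennreal (exp (s * real (bdim blk i)))))"
    using lborel_affine_euclidean[of c 0] unfolding T prod
    by (intro arg_cong[where f = "\<lambda>M. nn_integral M F"]) (simp add: c_def)
  also have "\<dots> = ennreal (exp (s * real (bdim blk i))) * (\<integral>\<^sup>+x. F (block_dilation blk i s x) \<partial>lborel)"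
    by (subst nn_integral_density) (auto simp: nn_integral_distr nn_integral_cmult)
  finally show ?thesis
    by (simp add: mult.assoc[symmetric] ennreal_mult[symmetric] exp_add[symmetric])
qed

section \<open>Hardy's inequality on C_0^1\<close>

text \<open>If m is a coordinate of block i, the exceptional set lies in the null hyperplane x_m =
  0. Off it the dilations carry x out of every bounded set, as the pointwise estimate
  requires.\<close>

lemma AE_bcomp_nonzero:
  fixes blk :: "'n::finite \<Rightarrow> nat"
  assumes "0 < bdim blk i"
  shows "AE x in lborel. bcomp blk i x \<noteq> 0"
proof -
  obtain m where m: "blk m = i"
    using assms by (force simp: bdim_def card_gt_0_iff)
  have "negligible {x :: real ^ 'n. axis m 1 \<bullet> x = 0}"
    by (rule negligible_hyperplane) (simp add: axis_eq_0_iff)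
  then have "AE x in lebesgue. x \<notin> {x :: real ^ 'n. axis m 1 \<bullet> x = 0}"
    by (intro AE_not_in) (simp add: negligible_iff_null_sets)
  then have "AE x in lborel. x \<notin> {x :: real ^ 'n. axis m 1 \<bullet> x = 0}"
    by (simp add: AE_completion_iff)
  then show ?thesis
    by eventually_elim (use m in \<open>auto simp: inner_axis' bcomp_def vec_eq_iff\<close>)
qed

lemma continuous_on_block_gradient_C01:
  assumes "\<phi> \<in> C01 \<Omega>"
  shows "continuous_on UNIV (block_gradient blk i \<phi>)"
  using assms unfolding block_gradient_def[abs_def] C01_def
  by (intro continuous_on_bcomp continuous_on_vec_lambda) auto

lemma C01_differentiable: "\<phi> \<in> C01 \<Omega> \<Longrightarrow> \<phi> differentiable at x"
  by (auto simp: C01_def differentiable_on_def)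

lemma nn_integral_exp_atLeast_0:
  fixes d :: real
  assumes "0 < d"
  shows "(\<integral>\<^sup>+s. ennreal (exp (- d * s)) * indicator {0..} s \<partial>lborel) = ennreal (1 / d)"
proof -
  have "LIM s at_top. - d * s :> at_bot"
    using assms by (intro filterlim_tendsto_neg_mult_at_bot[OF tendsto_const _ filterlim_ident]) auto
  then have "((\<lambda>s. - (exp (- d * s) / d)) \<longlongrightarrow> - (0 / d)) at_top"
    using assms by (intro tendsto_intros filterlim_compose[OF exp_at_bot]) auto
  then show ?thesis
    using assms
    by (subst nn_integral_FTC_atLeast[where F = "\<lambda>s. - (exp (- d * s) / d)"])
       (auto intro!: derivative_eq_intros)
qed

text \<open>Dilating a nonzero x^(i) far enough moves the point beyond the bounded support.\<close>

lemma C01_block_dilation_eventually_0: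
  assumes "\<phi> \<in> C01 \<Omega>" "bcomp blk i x \<noteq> 0"
  obtains T where "0 \<le> T" "\<phi> (block_dilation blk i T x) = 0"
proof -
  have "bounded {x. \<phi> x \<noteq> 0}"
    using assms(1) by (auto simp: C01_def intro: bounded_subset[OF compact_imp_bounded closure_subset])
  then obtain M where M: "\<And>y. \<phi> y \<noteq> 0 \<Longrightarrow> norm y \<le> M"
    by (auto simp: bounded_iff)
  \<comment> \<open>The logarithm solves e^T |x^(i)| = |M| + 1, which exceeds M; its absolute value
    only enlarges T and makes it nonnegative.\<close>
  define T where "T = \<bar>ln ((\<bar>M\<bar> + 1) / norm (bcomp blk i x))\<bar>"
  have "(\<bar>M\<bar> + 1) / norm (bcomp blk i x) = exp (ln ((\<bar>M\<bar> + 1) / norm (bcomp blk i x)))"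
    using assms(2) by (subst exp_ln) (auto intro!: divide_pos_pos)
  also have "\<dots> \<le> exp T"
    by (simp add: T_def)
  finally have "\<bar>M\<bar> + 1 \<le> norm (bcomp blk i (block_dilation blk i T x))"
    using assms(2) by (simp add: bcomp_block_dilation field_simps)
  also have "\<dots> \<le> norm (block_dilation blk i T x)"
    by (rule norm_bcomp_le)
  finally have "\<phi> (block_dilation blk i T x) = 0"
    using M by force
  then show ?thesis
    by (intro that[of T]) (auto simp: T_def)
qed

text \<open>The one-dimensional estimate is applied to s \<mapsto> \<phi>(D_s x), whose derivative
  is at most e^s |x^(i)| times the norm of the block gradient at D_s x. In the p-th power the factor
  |x^(i)|^p does not depend on s and is divided out, while e^(ps) joins the weight.\<close>

lemma C01_abs_powr_le_block_dilation:
  assumes \<phi>: "\<phi> \<in> C01 \<Omega>" and p: "1 < p" and d: "0 < d" and x: "bcomp blk i x \<noteq> 0"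
  shows "ennreal (\<bar>\<phi> x\<bar> powr p) / ennreal (norm (bcomp blk i x) powr p)
    \<le> (\<integral>\<^sup>+s. ennreal (d powr (1 - p) * exp (((p - 1) * d + p) * s)) *
          ennreal (norm (block_gradient blk i \<phi> (block_dilation blk i s x)) powr p) * indicator {0..} s \<partial>lborel)"
proof -
  define D where "D s = block_dilation blk i s x" for s
  define r where "r = norm (bcomp blk i x)"
  define f' where "f' s = frechet_derivative \<phi> (at (D s)) (bcomp blk i (D s))" for s
  define g where "g s = norm (bcomp blk i (D s)) * norm (block_gradient blk i \<phi> (D s))" for s
  note diff = C01_differentiable[OF \<phi>]
  have grad: "continuous_on UNIV (block_gradient blk i \<phi>)"
    using \<phi> by (rule continuous_on_block_gradient_C01)
  have D: "continuous_on UNIV D"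
    unfolding D_def[abs_def] by (intro continuous_intros)
  have gradD: "continuous_on UNIV (\<lambda>s. block_gradient blk i \<phi> (D s))"
    using continuous_on_compose2[OF grad D] by simp
  have [measurable]: "(\<lambda>s. block_gradient blk i \<phi> (D s)) \<in> borel_measurable borel"
    using gradD by (rule borel_measurable_continuous_onI)
  define I where "I = (\<integral>\<^sup>+s. ennreal (d powr (1 - p) * exp (((p - 1) * d + p) * s)) *
          ennreal (norm (block_gradient blk i \<phi> (D s)) powr p) * indicator {0..} s \<partial>lborel)"
  have r: "0 < r"
    using x by (simp add: r_def)
  obtain T where T: "0 \<le> T" "\<phi> (D T) = 0"
    using C01_block_dilation_eventually_0[OF \<phi> x] unfolding D_def by blast
  have f: "((\<lambda>s. \<phi> (D s)) has_real_derivative f' s) (at s)" for s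
  proof -
    have "(\<phi> \<circ> D has_vector_derivative f' s) (at s)"
      using vector_derivative_diff_chain_within[of D _ s UNIV \<phi> "frechet_derivative \<phi> (at (D s))"]
        has_vector_derivative_block_dilation[of blk i x s]
        frechet_derivative_works[THEN iffD1, OF diff[of "D s"]]
      by (simp add: D_def[abs_def] f'_def has_derivative_at_withinI)
    then show ?thesis
      by (simp add: has_real_derivative_iff_has_vector_derivative o_def)
  qed
  have "continuous_on UNIV g"
    unfolding g_def by (intro continuous_intros gradD D)
  moreover have "\<bar>f' s\<bar> \<le> g s" for s
    unfolding f'_def g_def by (rule frechet_derivative_bcomp_le[OF diff])
  ultimately have "ennreal (\<bar>\<phi> (D 0)\<bar> powr p)
      \<le> (\<integral>\<^sup>+s. ennreal (d powr (1 - p) * exp ((p - 1) * d * s) * g s powr p) * indicator {0..} s \<partial>lborel)"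
    using abs_powr_le_exp_weighted_nn_integral[OF p d T f] by blast
  also have "\<dots> = (\<integral>\<^sup>+s. ennreal (r powr p) * (ennreal (d powr (1 - p) * exp (((p - 1) * d + p) * s)) *
          ennreal (norm (block_gradient blk i \<phi> (D s)) powr p) * indicator {0..} s) \<partial>lborel)"
  proof (intro nn_integral_cong)
    fix s
    have "d powr (1 - p) * exp ((p - 1) * d * s) * g s powr p
        = r powr p * (d powr (1 - p) * exp (((p - 1) * d + p) * s) * norm (block_gradient blk i \<phi> (D s)) powr p)"
      using r by (simp add: g_def D_def bcomp_block_dilation powr_mult r_def[symmetric] exp_powr_real
          exp_add distrib_right mult.commute[of s])
    then have "ennreal (d powr (1 - p) * exp ((p - 1) * d * s) * g s powr p)
        = ennreal (r powr p) * (ennreal (d powr (1 - p) * exp (((p - 1) * d + p) * s)) *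
          ennreal (norm (block_gradient blk i \<phi> (D s)) powr p))"
      by (simp only: ennreal_mult powr_ge_zero exp_ge_zero mult_nonneg_nonneg)
    then show "ennreal (d powr (1 - p) * exp ((p - 1) * d * s) * g s powr p) * indicator {0..} s
        = ennreal (r powr p) * (ennreal (d powr (1 - p) * exp (((p - 1) * d + p) * s)) *
          ennreal (norm (block_gradient blk i \<phi> (D s)) powr p) * indicator {0..} s)"
      by (simp only: mult.assoc)
  qed
  also have "\<dots> = ennreal (r powr p) * I"
    unfolding I_def by (intro nn_integral_cmult) measurable
  finally have "ennreal (\<bar>\<phi> x\<bar> powr p) \<le> I * ennreal (r powr p)"
    by (simp add: D_def mult.commute)
  then have "ennreal (\<bar>\<phi> x\<bar> powr p) / ennreal (r powr p) \<le> I * ennreal (r powr p) / ennreal (r powr p)"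
    by (rule divide_right_mono_ennreal)
  also have "\<dots> = I"
    using r by (simp add: ennreal_mult_divide_eq)
  finally show ?thesis
    by (simp add: r_def D_def I_def)
qed

lemma hardy_inequality_C01:
  fixes blk :: "'n::finite \<Rightarrow> nat"
  assumes \<phi>: "\<phi> \<in> C01 \<Omega>" and p: "1 < p" "p < real (bdim blk i)"
  shows "ennreal (((real (bdim blk i) - p) / p) powr p) *
      (\<integral>\<^sup>+x. ennreal (\<bar>\<phi> x\<bar> powr p) / ennreal (norm (bcomp blk i x) powr p) \<partial>lborel)
    \<le> (\<integral>\<^sup>+x. ennreal (norm (block_gradient blk i \<phi> x) powr p) \<partial>lborel)"
proof -
  \<comment> \<open>The pointwise bound and the Jacobian leave the integral of e^(((p-1)d + p -
    N_i)s) over s \<ge> 0. This d minimises the resulting constant d^(1-p) / (N_i - p - (p-1)d), and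
    it turns the exponent into -ds.\<close>
  define d where "d = (real (bdim blk i) - p) / p"
  have d: "0 < d" "p * d = real (bdim blk i) - p"
    using p by (auto simp: d_def)
  define K where "K s = d powr (1 - p) * exp (((p - 1) * d + p) * s)" for s
  define B where "B x = ennreal (norm (block_gradient blk i \<phi> x) powr p)" for x
  have [measurable]: "K \<in> borel_measurable borel"
    unfolding K_def by (intro borel_measurable_continuous_onI continuous_intros)
  have "continuous_on UNIV (block_gradient blk i \<phi>)"
    using \<phi> by (rule continuous_on_block_gradient_C01)
  then have [measurable]: "block_gradient blk i \<phi> \<in> borel_measurable borel"
    by (rule borel_measurable_continuous_onI)
  have B[measurable]: "B \<in> borel_measurable borel"
    unfolding B_def by measurable
  have "continuous_on UNIV (\<lambda>z :: (real ^ 'n) \<times> real. block_dilation blk i (snd z) (fst z))"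
    by (intro continuous_intros)
  then have dil[measurable]: "(\<lambda>z :: (real ^ 'n) \<times> real. block_dilation blk i (snd z) (fst z)) \<in> borel_measurable (borel \<Otimes>\<^sub>M borel)"
    unfolding borel_prod by (rule borel_measurable_continuous_onI)
  have dils[measurable]: "block_dilation blk i s \<in> borel_measurable borel" for s
    by (intro borel_measurable_continuous_onI continuous_intros)
  have "0 < bdim blk i"
    using p by (auto intro: gr0I)
  then have nonzero: "AE x in lborel. bcomp blk i x \<noteq> 0"
    by (rule AE_bcomp_nonzero)
  have "(\<integral>\<^sup>+x. ennreal (\<bar>\<phi> x\<bar> powr p) / ennreal (norm (bcomp blk i x) powr p) \<partial>lborel)
     \<le> (\<integral>\<^sup>+x. \<integral>\<^sup>+s. ennreal (K s) * B (block_dilation blk i s x) * indicator {0..} s \<partial>lborel \<partial>lborel)"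
    unfolding K_def B_def
    by (intro nn_integral_mono_AE, use nonzero in eventually_elim)
       (rule C01_abs_powr_le_block_dilation[OF \<phi> p(1) d(1)])
  \<comment> \<open>Tonelli: the integrand is nonnegative, so joint measurability suffices, and it
    follows from the joint continuity of the dilation in (x, s).\<close>
  also have "\<dots> = (\<integral>\<^sup>+s. \<integral>\<^sup>+x. ennreal (K s) * B (block_dilation blk i s x) * indicator {0..} s \<partial>lborel \<partial>lborel)"
  proof (rule lborel_pair.Fubini'[symmetric])
    have [measurable]: "(\<lambda>z :: (real ^ 'n) \<times> real. B (block_dilation blk i (snd z) (fst z))) \<in> borel_measurable (borel \<Otimes>\<^sub>M borel)"
      by (rule measurable_compose[OF dil B])
    have "(\<lambda>z :: (real ^ 'n) \<times> real. ennreal (K (snd z)) * B (block_dilation blk i (snd z) (fst z)) * indicator {0..} (snd z))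
        \<in> borel_measurable (borel \<Otimes>\<^sub>M borel)"
      by measurable
    then show "(\<lambda>(x, s). ennreal (K s) * B (block_dilation blk i s x) * indicator {0..} s)
        \<in> borel_measurable (lborel \<Otimes>\<^sub>M lborel)"
      unfolding case_prod_beta measurable_cong_sets[OF sets_pair_measure_cong[OF sets_lborel sets_lborel] refl] .
  qed
  also have "\<dots> = (\<integral>\<^sup>+s. ennreal (d powr (1 - p)) * (\<integral>\<^sup>+x. B x \<partial>lborel) * (ennreal (exp (- d * s)) * indicator {0..} s) \<partial>lborel)"
  proof (intro nn_integral_cong)
    fix s
    have "(\<integral>\<^sup>+x. ennreal (K s) * B (block_dilation blk i s x) * indicator {0..} s \<partial>lborel)
        = ennreal (K s) * (ennreal (exp (- s * real (bdim blk i))) * (\<integral>\<^sup>+x. B x \<partial>lborel)) * indicator {0..} s"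
      by (simp add: nn_integral_multc nn_integral_cmult nn_integral_block_dilation)
    also have "\<dots> = ennreal (K s * exp (- s * real (bdim blk i))) * (\<integral>\<^sup>+x. B x \<partial>lborel) * indicator {0..} s"
      by (simp add: ennreal_mult K_def mult.assoc)
    also have "K s * exp (- s * real (bdim blk i)) = d powr (1 - p) * exp (- d * s)"
    proof -
      have "((p - 1) * d + p) * s + - s * real (bdim blk i) = - d * s + s * (p * d + p - real (bdim blk i))"
        by (simp add: algebra_simps)
      also have "\<dots> = - d * s"
        using d(2) by simp
      finally show ?thesis
        by (simp add: K_def mult.assoc exp_add[symmetric])
    qed
    finally show "(\<integral>\<^sup>+x. ennreal (K s) * B (block_dilation blk i s x) * indicator {0..} s \<partial>lborel)
        = ennreal (d powr (1 - p)) * (\<integral>\<^sup>+x. B x \<partial>lborel) * (ennreal (exp (- d * s)) * indicator {0..} s)"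
      by (simp add: ennreal_mult mult_ac)
  qed
  also have "\<dots> = ennreal (d powr (1 - p)) * (\<integral>\<^sup>+x. B x \<partial>lborel) * ennreal (1 / d)"
    using nn_integral_exp_atLeast_0[OF d(1)] by (subst nn_integral_cmult) auto
  also have "\<dots> = ennreal (d powr (1 - p) * (1 / d)) * (\<integral>\<^sup>+x. B x \<partial>lborel)"
    using d by (simp only: ennreal_mult powr_ge_zero mult_ac divide_nonneg_nonneg zero_le_one less_imp_le)
  \<comment> \<open>The factor d^(1-p) from Young's inequality and 1/d from the s-integral combine
    to d^(-p), which the Hardy constant d^p cancels.\<close>
  also have "d powr (1 - p) * (1 / d) = d powr (- p)"
    using d(1) by (simp add: powr_diff powr_minus field_simps)
  finally have "ennreal (d powr p) * (\<integral>\<^sup>+x. ennreal (\<bar>\<phi> x\<bar> powr p) / ennreal (norm (bcomp blk i x) powr p) \<partial>lborel)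
     \<le> ennreal (d powr p) * (ennreal (d powr (- p)) * (\<integral>\<^sup>+x. B x \<partial>lborel))"
    by (intro mult_left_mono) auto
  also have "\<dots> = (\<integral>\<^sup>+x. B x \<partial>lborel)"
    using d(1) by (simp add: mult.assoc[symmetric] ennreal_mult[symmetric] powr_minus)
  finally show ?thesis
    by (simp add: d_def B_def)
qed

section \<open>Passing to the limit in the two integrals\<close>

text \<open>Convexity of the p-th power at the points a/(1 - t) and b/t with weights 1 - t and t.
  For small t the coefficient of \<open>a powr p\<close> is close to 1; the large coefficient of
  \<open>b powr p\<close> will multiply an error that tends to 0.\<close>

lemma powr_add_le_weighted:
  fixes a b p t :: real
  assumes p: "1 \<le> p" and ab: "0 \<le> a" "0 \<le> b" and t: "0 < t" "t < 1"
  shows "(a + b) powr p \<le> (1 - t) powr (1 - p) * a powr p + t powr (1 - p) * b powr p"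
proof -
  \<comment> \<open>If a or b is 0, it is enough that the coefficient of the remaining term is at
    least 1.\<close>
  have ge_1: "1 \<le> s powr (1 - p)" if "0 < s" "s < 1" for s :: real
    using that p powr_mono'[of "1 - p" 0 s] by simp
  consider "a = 0" | "b = 0" | "0 < a" "0 < b"
    using ab by linarith
  then show ?thesis
  proof cases
    case 1
    then show ?thesis
      using ge_1[OF t] by (simp add: mult_le_cancel_right1)
  next
    case 2
    then show ?thesis
      using ge_1[of "1 - t"] t by (simp add: mult_le_cancel_right1)
  next
    case 3
    have "((1 - t) *\<^sub>R (a / (1 - t)) + t *\<^sub>R (b / t)) powr p
        \<le> (1 - t) * (a / (1 - t)) powr p + t * (b / t) powr p"
      using t 3 by (intro convex_onD[OF powr_convex[OF p]]) auto
    also have "(1 - t) *\<^sub>R (a / (1 - t)) + t *\<^sub>R (b / t) = a + b"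
      using t by simp
    also have "(1 - t) * (a / (1 - t)) powr p = (1 - t) powr (1 - p) * a powr p"
      using t 3 by (simp add: powr_divide powr_diff)
    also have "t * (b / t) powr p = t powr (1 - p) * b powr p"
      using t 3 by (simp add: powr_divide powr_diff)
    finally show ?thesis .
  qed
qed

lemma Lp_norm_tendsto_0D:
  assumes p: "0 < p" and lim: "(\<lambda>n. Lp_norm p \<Omega> (F n)) \<longlonglongrightarrow> 0"
  shows "(\<lambda>n. \<integral>\<^sup>+x. ennreal (norm (F n x) powr p) \<partial>lebesgue_on \<Omega>) \<longlonglongrightarrow> 0"
proof -
  define I where "I n = (\<integral>\<^sup>+x. ennreal (norm (F n x) powr p) \<partial>lebesgue_on \<Omega>)" for n
  have "(\<lambda>n. enn2real (Lp_norm p \<Omega> (F n))) \<longlonglongrightarrow> 0"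
    using lim by (intro tendsto_enn2real) auto
  then have "(\<lambda>n. enn2real (Lp_norm p \<Omega> (F n)) powr p) \<longlonglongrightarrow> 0 powr p"
    using p by (intro tendsto_powr2) (auto intro: tendsto_intros)
  then have "(\<lambda>n. ennreal (enn2real (Lp_norm p \<Omega> (F n)) powr p)) \<longlonglongrightarrow> 0"
    using tendsto_ennrealI by fastforce
  \<comment> \<open>\<open>enn2real\<close> sends infinity to 0, so the p-th power recovers the
    integral only where the norm is finite; convergence to 0 ensures this eventually.\<close>
  moreover have "\<forall>\<^sub>F n in sequentially. ennreal (enn2real (Lp_norm p \<Omega> (F n)) powr p) = I n"
    using order_tendstoD(2)[OF lim, of top, simplified]
  proof eventually_elim
    case (elim n)
    then have "I n \<noteq> top"
      by (auto simp: Lp_norm_def I_def[symmetric])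
    then show ?case
      using p by (simp add: Lp_norm_def I_def[symmetric] Let_def powr_powr less_top)
  qed
  ultimately show ?thesis
    unfolding I_def[symmetric] by (rule Lim_transform_eventually)
qed

text \<open>For fixed t the weighted power inequality is used with a = |G| and b = |F_n - G|; the
  second term vanishes as n grows, and then t tends to 0.\<close>

lemma limsup_nn_integral_norm_powr_le:
  fixes F :: "nat \<Rightarrow> 'a \<Rightarrow> 'b::{real_normed_vector, second_countable_topology}"
  assumes p: "1 \<le> p" and [measurable]: "\<And>n. F n \<in> borel_measurable M" "G \<in> borel_measurable M"
    and lim: "(\<lambda>n. \<integral>\<^sup>+x. ennreal (norm (F n x - G x) powr p) \<partial>M) \<longlonglongrightarrow> 0"
  shows "limsup (\<lambda>n. \<integral>\<^sup>+x. ennreal (norm (F n x) powr p) \<partial>M) \<le> (\<integral>\<^sup>+x. ennreal (norm (G x) powr p) \<partial>M)"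
    (is "?L \<le> ?G")
proof -
  have le: "?L \<le> ?G * ennreal ((1 - t) powr (1 - p))" if t: "0 < t" "t < 1" for t :: real
  proof -
    let ?I = "\<lambda>n. \<integral>\<^sup>+x. ennreal (norm (F n x - G x) powr p) \<partial>M"
    let ?R = "\<lambda>n. ennreal ((1 - t) powr (1 - p)) * ?G + ennreal (t powr (1 - p)) * ?I n"
    have "(\<integral>\<^sup>+x. ennreal (norm (F n x) powr p) \<partial>M) \<le> ?R n" for n
    proof -
      have "(\<integral>\<^sup>+x. ennreal (norm (F n x) powr p) \<partial>M)
        \<le> (\<integral>\<^sup>+x. ennreal ((1 - t) powr (1 - p)) * ennreal (norm (G x) powr p)
              + ennreal (t powr (1 - p)) * ennreal (norm (F n x - G x) powr p) \<partial>M)"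
      proof (intro nn_integral_mono)
        fix x
        have "norm (F n x) \<le> norm (G x) + norm (F n x - G x)"
          using norm_triangle_ineq[of "G x" "F n x - G x"] by simp
        then have "norm (F n x) powr p \<le> (norm (G x) + norm (F n x - G x)) powr p"
          using p by (intro powr_mono2) auto
        also have "\<dots> \<le> (1 - t) powr (1 - p) * norm (G x) powr p + t powr (1 - p) * norm (F n x - G x) powr p"
          using p t by (intro powr_add_le_weighted) auto
        finally show "ennreal (norm (F n x) powr p) \<le> ennreal ((1 - t) powr (1 - p)) * ennreal (norm (G x) powr p)
              + ennreal (t powr (1 - p)) * ennreal (norm (F n x - G x) powr p)"
          by (simp add: ennreal_mult[symmetric] ennreal_plus[symmetric] ennreal_leI del: ennreal_plus)
      qed
      also have "\<dots> = ?R n"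
        by (simp add: nn_integral_add nn_integral_cmult)
      finally show ?thesis .
    qed
    then have "?L \<le> limsup ?R"
      by (intro Limsup_mono) auto
    also have "\<dots> = ennreal ((1 - t) powr (1 - p)) * ?G + ennreal (t powr (1 - p)) * 0"
      by (intro lim_imp_Limsup tendsto_add tendsto_const ennreal_tendsto_cmult lim) auto
    finally show ?thesis
      by (simp add: mult.commute)
  qed
  show ?thesis
  proof (cases "?G = top")
    case False
    \<comment> \<open>The sequence t = 1/(n + 2) starts at 1/2, so 0 < t < 1 holds for every
      n.\<close>
    have "(\<lambda>n. 1 - inverse (real (Suc (Suc n)))) \<longlonglongrightarrow> 1 - 0"
      by (intro tendsto_intros LIMSEQ_Suc[OF LIMSEQ_inverse_real_of_nat])
    then have "(\<lambda>n. (1 - inverse (real (Suc (Suc n)))) powr (1 - p)) \<longlonglongrightarrow> 1 powr (1 - p)"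
      by (intro tendsto_powr tendsto_const) auto
    then have "(\<lambda>n. ?G * ennreal ((1 - inverse (real (Suc (Suc n)))) powr (1 - p))) \<longlonglongrightarrow> ?G * ennreal (1 powr (1 - p))"
      using False by (intro ennreal_tendsto_cmult tendsto_ennrealI) (auto simp: less_top)
    then have "?L \<le> ?G * ennreal (1 powr (1 - p))"
    proof (rule tendsto_lowerbound)
      have "?L \<le> ?G * ennreal ((1 - inverse (real (Suc (Suc n)))) powr (1 - p))" for n
        by (rule le) (auto simp: field_simps)
      then show "\<forall>\<^sub>F n in sequentially. ?L \<le> ?G * ennreal ((1 - inverse (real (Suc (Suc n)))) powr (1 - p))"
        by simp
    qed simp
    then show ?thesis by simp
  qed auto
qed

text \<open>Convergence in L^1 gives an almost everywhere convergent subsequence, to which Fatou's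
  lemma applies. The weight may be infinite, as the Hardy weight is where x^(i) = 0.\<close>

lemma nn_integral_powr_weighted_le_liminf_subseq:
  fixes \<phi> :: "nat \<Rightarrow> 'a \<Rightarrow> real" and w :: "'a \<Rightarrow> ennreal"
  assumes p: "0 < p"
    and [measurable]: "\<And>n. \<phi> n \<in> borel_measurable M" "u \<in> borel_measurable M" "w \<in> borel_measurable M"
    and lim: "(\<lambda>n. \<integral>\<^sup>+x. ennreal \<bar>\<phi> n x - u x\<bar> \<partial>M) \<longlonglongrightarrow> 0"
  obtains r :: "nat \<Rightarrow> nat" where "strict_mono r"
    "(\<integral>\<^sup>+x. ennreal (\<bar>u x\<bar> powr p) * w x \<partial>M) \<le> liminf (\<lambda>n. \<integral>\<^sup>+x. ennreal (\<bar>\<phi> (r n) x\<bar> powr p) * w x \<partial>M)"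
proof -
  \<comment> \<open>The first few differences may have infinite integral; shifting the sequence by
    \<open>N\<close> leaves integrable ones.\<close>
  obtain N where N: "\<And>n. N \<le> n \<Longrightarrow> (\<integral>\<^sup>+x. ennreal \<bar>\<phi> n x - u x\<bar> \<partial>M) < top"
    using order_tendstoD(2)[OF lim, of top] by (auto simp: eventually_sequentially)
  define \<psi> where "\<psi> n x = \<phi> (n + N) x - u x" for n x
  have [measurable]: "\<psi> n \<in> borel_measurable M" for n
    unfolding \<psi>_def by measurable
  have int: "integrable M (\<psi> n)" for n
    using N[of "n + N"] by (intro integrableI_bounded) (auto simp: \<psi>_def)
  have "(\<lambda>n. \<integral>\<^sup>+x. ennreal \<bar>\<psi> n x\<bar> \<partial>M) \<longlonglongrightarrow> 0"
    unfolding \<psi>_def by (rule LIMSEQ_ignore_initial_segment[OF lim])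
  then have "(\<lambda>n. enn2real (\<integral>\<^sup>+x. ennreal \<bar>\<psi> n x\<bar> \<partial>M)) \<longlonglongrightarrow> 0"
    by (intro tendsto_enn2real) auto
  then have "(\<lambda>n. \<integral>x. norm (\<psi> n x) \<partial>M) \<longlonglongrightarrow> 0"
    by (simp add: integral_eq_nn_integral)
  then obtain r :: "nat \<Rightarrow> nat" where r: "strict_mono r" "AE x in M. (\<lambda>n. \<psi> (r n) x) \<longlonglongrightarrow> 0"
    using tendsto_L1_AE_subseq[of M \<psi>, OF int] by blast
  define q where "q n = r n + N" for n
  have "AE x in M. ennreal (\<bar>u x\<bar> powr p) * w x \<le> liminf (\<lambda>n. ennreal (\<bar>\<phi> (q n) x\<bar> powr p) * w x)"
    using r(2)
  proof eventually_elim
    case (elim x)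
    show ?case
    \<comment> \<open>Multiplication in \<open>ennreal\<close> is discontinuous at 0 times infinity.
      If u x = 0 the left side is 0 whatever the weight; otherwise the limit factor is positive and
      the product converges even for infinite weight.\<close>
    proof (cases "u x = 0")
      case False
      have "(\<lambda>n. \<phi> (q n) x) \<longlonglongrightarrow> u x"
        using elim by (simp add: \<psi>_def q_def LIM_zero_iff)
      then have "(\<lambda>n. \<bar>\<phi> (q n) x\<bar> powr p) \<longlonglongrightarrow> \<bar>u x\<bar> powr p"
        using p False by (intro tendsto_powr tendsto_rabs tendsto_const) auto
      then have "(\<lambda>n. ennreal (\<bar>\<phi> (q n) x\<bar> powr p) * w x) \<longlonglongrightarrow> ennreal (\<bar>u x\<bar> powr p) * w x"
        using False by (intro tendsto_mult_ennreal tendsto_ennrealI tendsto_const) auto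
      then show ?thesis
        using lim_imp_Liminf[OF sequentially_bot] by (metis order_refl)
    qed simp
  qed
  then have "(\<integral>\<^sup>+x. ennreal (\<bar>u x\<bar> powr p) * w x \<partial>M) \<le> (\<integral>\<^sup>+x. liminf (\<lambda>n. ennreal (\<bar>\<phi> (q n) x\<bar> powr p) * w x) \<partial>M)"
    by (rule nn_integral_mono_AE)
  also have "\<dots> \<le> liminf (\<lambda>n. \<integral>\<^sup>+x. ennreal (\<bar>\<phi> (q n) x\<bar> powr p) * w x \<partial>M)"
    by (intro nn_integral_liminf) measurable
  finally show ?thesis
    using r(1) by (intro that[of q]) (auto simp: q_def strict_mono_def)
qed

text \<open>Monotone convergence along a compact exhaustion of \<Omega>. It transfers to \<Omega> a
  bound that the convergence in L^1_loc yields only on compact subsets.\<close>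

lemma nn_integral_lebesgue_on_open_le:
  fixes f :: "'a::euclidean_space \<Rightarrow> ennreal"
  assumes "open \<Omega>" and f: "f \<in> borel_measurable (lebesgue_on \<Omega>)"
    and le: "\<And>K. compact K \<Longrightarrow> K \<subseteq> \<Omega> \<Longrightarrow> (\<integral>\<^sup>+x. f x \<partial>lebesgue_on K) \<le> B"
  shows "(\<integral>\<^sup>+x. f x \<partial>lebesgue_on \<Omega>) \<le> B"
proof -
  obtain C where C: "\<And>n. compact (C n)" "\<And>n. C n \<subseteq> \<Omega>" "\<And>n. C n \<subseteq> interior (C (Suc n))" "\<Union> (range C) = \<Omega>"
    using open_Union_compact_subsets[OF assms(1)] by metis
  have leb: "\<Omega> \<in> sets lebesgue" "C n \<in> sets lebesgue" for n
    using assms(1) C(1)[of n] by (auto intro: fmeasurableD lmeasurable_compact)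
  have "incseq C"
    using C(3) interior_subset by (intro incseq_SucI) blast
  \<comment> \<open>Measurability of f is known only on \<Omega>, so monotone convergence on the
    whole space is applied to its extension by zero.\<close>
  have f': "(\<lambda>x. f x * indicator \<Omega> x) \<in> borel_measurable lebesgue"
    using f leb by (simp add: borel_measurable_restrict_space_iff_ennreal)
  have C': "(\<integral>\<^sup>+x. f x * indicator \<Omega> x * indicator (C n) x \<partial>lebesgue) \<le> B" for n
  proof -
    have "(\<integral>\<^sup>+x. f x * indicator \<Omega> x * indicator (C n) x \<partial>lebesgue) = (\<integral>\<^sup>+x. f x * indicator (C n) x \<partial>lebesgue)"
      using C(2)[of n] by (intro nn_integral_cong) (auto simp: indicator_def)
    also have "\<dots> \<le> B"
      using le[OF C(1,2)] leb by (simp add: nn_integral_restrict_space)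
    finally show ?thesis .
  qed
  have "(\<integral>\<^sup>+x. f x \<partial>lebesgue_on \<Omega>) = (\<integral>\<^sup>+x. (SUP n. f x * indicator \<Omega> x * indicator (C n) x) \<partial>lebesgue)"
    using leb
  proof (simp add: nn_integral_restrict_space, intro nn_integral_cong)
    fix x
    show "f x * indicator \<Omega> x = (SUP n. f x * indicator \<Omega> x * indicator (C n) x)"
    proof (cases "x \<in> \<Omega>")
      case True
      then obtain n where "x \<in> C n"
        using C(4) by blast
      with True show ?thesis
        by (intro antisym SUP_upper2[of n] SUP_least) (auto simp: indicator_def)
    qed simp
  qed
  also have "\<dots> = (SUP n. \<integral>\<^sup>+x. f x * indicator \<Omega> x * indicator (C n) x \<partial>lebesgue)"
    using f' leb \<open>incseq C\<close>
    by (intro nn_integral_monotone_convergence_SUP)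
       (auto simp: incseq_def le_fun_def indicator_def)
  also have "\<dots> \<le> B"
    using C' by (intro SUP_least) auto
  finally show ?thesis .
qed

section \<open>Comparison with the homogeneous norms\<close>

lemma sigma_ge_1:
  assumes "\<And>i j. 1 \<le> j \<Longrightarrow> j < i \<Longrightarrow> i \<le> k \<Longrightarrow> 0 \<le> \<alpha> i j" and "i \<le> k"
  shows "1 \<le> sigma \<alpha> i"
  using assms(2)
proof (induction i rule: less_induct)
  case (less i)
  have "0 \<le> \<alpha> i j * sigma \<alpha> j" if "j \<in> {1..<i}" for j
  proof -
    have "1 \<le> sigma \<alpha> j"
      using less that by auto
    then show ?thesis
      using assms(1)[of j i] that less.prems by (intro mult_nonneg_nonneg) auto
  qed
  then have "0 \<le> (\<Sum>j\<in>{1..<i}. \<alpha> i j * sigma \<alpha> j)"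
    by (rule sum_nonneg)
  then show ?case
    by (subst sigma.simps) simp
qed

text \<open>Since \<open>sigma \<alpha> 1 = 1\<close>, omitting the factor i = 1 does not change the
  product, so the outer root exactly undoes the exponent of the first summand; the other summands
  are nonnegative. A general y covers both norms.\<close>

lemma first_le_homogeneous_norm:
  fixes y :: "nat \<Rightarrow> real"
  assumes sigma: "\<And>i. i \<le> k \<Longrightarrow> 1 \<le> sigma \<alpha> i" and "1 \<le> k" "0 \<le> y 1"
  shows "y 1 \<le> (\<Sum>j\<in>{1..k}. y j powr (2 * (\<Prod>i\<in>{1..k} - {j}. sigma \<alpha> i)))
    powr (1 / (2 * (\<Prod>i\<in>{1..k}. sigma \<alpha> i)))"
proof -
  define P where "P = (\<Prod>i\<in>{1..k} - {1}. sigma \<alpha> i)"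
  have P: "0 < P"
    unfolding P_def using sigma by (intro prod_pos) (force intro: less_le_trans[OF zero_less_one])
  have prod: "(\<Prod>i\<in>{1..k}. sigma \<alpha> i) = P"
    unfolding P_def using \<open>1 \<le> k\<close> sigma_1[of \<alpha>] by (subst prod.remove[of _ 1]) auto
  have "y 1 = (y 1 powr (2 * P)) powr (1 / (2 * P))"
    using P \<open>0 \<le> y 1\<close> by (simp add: powr_powr)
  also have "\<dots> \<le> (\<Sum>j\<in>{1..k}. y j powr (2 * (\<Prod>i\<in>{1..k} - {j}. sigma \<alpha> i))) powr (1 / (2 * P))"
    using P \<open>1 \<le> k\<close> unfolding P_def
    by (intro powr_mono2 member_le_sum[where f = "\<lambda>j. y j powr (2 * (\<Prod>i\<in>{1..k} - {j}. sigma \<alpha> i))"]) auto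
  finally show ?thesis
    unfolding prod .
qed

lemma inverse_ennreal_antimono:
  assumes "0 \<le> a" "a \<le> b"
  shows "inverse (ennreal b) \<le> inverse (ennreal a)"
  using assms by (cases "a = 0") (auto simp: inverse_ennreal intro!: ennreal_leI le_imp_inverse_le)

section \<open>Hardy's inequality on the closure of C_0^1\<close>

lemma pderivative_C01_outside:
  assumes "\<phi> \<in> C01 \<Omega>" "x \<notin> \<Omega>"
  shows "pderivative m \<phi> x = 0"
proof -
  have "x \<in> - closure {x. \<phi> x \<noteq> 0}" "open (- closure {x. \<phi> x \<noteq> 0})"
    using assms by (auto simp: C01_def)
  moreover have "0 = \<phi> y" if "y \<in> - closure {x. \<phi> x \<noteq> 0}" for y
    using that closure_subset[of "{x. \<phi> x \<noteq> 0}"] by auto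
  ultimately have "(\<phi> has_derivative (\<lambda>_. 0)) (at x)"
    using has_derivative_transform_within_open[OF has_derivative_const[of 0]] by blast
  then show ?thesis
    by (simp add: pderivative_def frechet_derivative_at[symmetric])
qed

lemma norm_block_gradient_le_lam_gradient:
  assumes "\<And>x. lam blk k \<alpha> i x = 1"
  shows "norm (block_gradient blk i \<phi> x) \<le> norm (lam_gradient blk k \<alpha> \<phi> x)"
  by (rule norm_le_componentwise_cart) (simp add: block_gradient_def bcomp_def lam_gradient_def assms)

lemma borel_measurable_bcomp [measurable]: "bcomp blk i \<in> borel_measurable borel"
  by (intro borel_measurable_continuous_onI continuous_intros)

text \<open>The left integral grows when K is replaced by the whole space, and the right one loses
  nothing on restriction to \<Omega>, as the gradient vanishes outside. The constant sits inside the
  weight to match the form used with Fatou's lemma.\<close>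

lemma hardy_inequality_C01_lam_gradient:
  fixes blk :: "'n::finite \<Rightarrow> nat"
  assumes \<phi>: "\<phi> \<in> C01 \<Omega>" and p: "1 < p" "p < real (bdim blk i)"
    and lam: "\<And>x. lam blk k \<alpha> i x = 1"
    and sets: "\<Omega> \<in> sets lebesgue" "K \<in> sets lebesgue"
  shows "(\<integral>\<^sup>+x. ennreal (\<bar>\<phi> x\<bar> powr p) * (ennreal (((real (bdim blk i) - p) / p) powr p)
      / ennreal (norm (bcomp blk i x) powr p)) \<partial>lebesgue_on K)
    \<le> (\<integral>\<^sup>+x. ennreal (norm (lam_gradient blk k \<alpha> \<phi> x) powr p) \<partial>lebesgue_on \<Omega>)"
proof -
  let ?C = "ennreal (((real (bdim blk i) - p) / p) powr p)"
  let ?h = "\<lambda>x. ennreal (norm (bcomp blk i x) powr p)"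
  have [measurable]: "\<phi> \<in> borel_measurable borel"
    using \<phi> by (auto simp: C01_def intro!: borel_measurable_continuous_onI differentiable_imp_continuous_on)
  have "(\<integral>\<^sup>+x. ennreal (\<bar>\<phi> x\<bar> powr p) * (?C / ?h x) \<partial>lebesgue_on K)
      \<le> (\<integral>\<^sup>+x. ennreal (\<bar>\<phi> x\<bar> powr p) * (?C / ?h x) \<partial>lebesgue)"
    using sets by (simp add: nn_integral_restrict_space) (intro nn_integral_mono, simp add: indicator_def)
  also have "\<dots> = (\<integral>\<^sup>+x. ?C * (ennreal (\<bar>\<phi> x\<bar> powr p) / ?h x) \<partial>lborel)"
    unfolding nn_integral_completion
    by (intro nn_integral_cong) (simp add: divide_ennreal_def mult_ac)
  also have "\<dots> = ?C * (\<integral>\<^sup>+x. ennreal (\<bar>\<phi> x\<bar> powr p) / ?h x \<partial>lborel)"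
    by (intro nn_integral_cmult) measurable
  also have "\<dots> \<le> (\<integral>\<^sup>+x. ennreal (norm (block_gradient blk i \<phi> x) powr p) \<partial>lborel)"
    by (rule hardy_inequality_C01[OF \<phi> p])
  also have "\<dots> \<le> (\<integral>\<^sup>+x. ennreal (norm (lam_gradient blk k \<alpha> \<phi> x) powr p) * indicator \<Omega> x \<partial>lborel)"
  proof (intro nn_integral_mono)
    fix x
    show "ennreal (norm (block_gradient blk i \<phi> x) powr p)
        \<le> ennreal (norm (lam_gradient blk k \<alpha> \<phi> x) powr p) * indicator \<Omega> x"
    proof (cases "x \<in> \<Omega>")
      case True
      then show ?thesis
        using p norm_block_gradient_le_lam_gradient[OF lam, of \<phi> x]
        by (auto intro!: ennreal_leI powr_mono2)
    next
      case False
      then have "block_gradient blk i \<phi> x = 0"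
        by (simp add: block_gradient_def bcomp_def pderivative_C01_outside[OF \<phi>] vec_eq_iff)
      then show ?thesis
        by simp
    qed
  qed
  also have "\<dots> = (\<integral>\<^sup>+x. ennreal (norm (lam_gradient blk k \<alpha> \<phi> x) powr p) \<partial>lebesgue_on \<Omega>)"
    using sets by (simp add: nn_integral_restrict_space nn_integral_completion)
  finally show ?thesis .
qed

text \<open>On each compact K the left side is lower semicontinuous along a subsequence, while the
  gradient integrals are controlled in the upper limit. The resulting bound is independent of K, so
  K can exhaust \<Omega>.\<close>

lemma hardy_inequality_has_lam_gradient:
  fixes blk :: "'n::finite \<Rightarrow> nat"
  assumes "open \<Omega>" and p: "1 < p" "p < real (bdim blk i)"
    and lam: "\<And>x. lam blk k \<alpha> i x = 1"
    and G: "has_lam_gradient blk k \<alpha> p \<Omega> u G"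
  shows "ennreal (((real (bdim blk i) - p) / p) powr p) *
      (\<integral>\<^sup>+x. ennreal (\<bar>u x\<bar> powr p) / ennreal (norm (bcomp blk i x) powr p) \<partial>lebesgue_on \<Omega>)
    \<le> (\<integral>\<^sup>+x. ennreal (norm (G x) powr p) \<partial>lebesgue_on \<Omega>)"
proof -
  let ?C = "ennreal (((real (bdim blk i) - p) / p) powr p)"
  let ?h = "\<lambda>x. ennreal (norm (bcomp blk i x) powr p)"
  let ?w = "\<lambda>x. ?C / ?h x"
  obtain \<phi> where u[measurable]: "u \<in> borel_measurable (lebesgue_on \<Omega>)" and [measurable]: "G \<in> borel_measurable (lebesgue_on \<Omega>)"
    and \<phi>: "\<And>n. \<phi> n \<in> C01 \<Omega>"
    and grad: "(\<lambda>n. Lp_norm p \<Omega> (\<lambda>x. lam_gradient blk k \<alpha> (\<phi> n) x - G x)) \<longlonglongrightarrow> 0"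
    and L1: "\<And>K. compact K \<Longrightarrow> K \<subseteq> \<Omega> \<Longrightarrow> (\<lambda>n. \<integral>\<^sup>+x. ennreal \<bar>\<phi> n x - u x\<bar> \<partial>lebesgue_on K) \<longlonglongrightarrow> 0"
    using G unfolding has_lam_gradient_def by blast
  have meas: "\<phi> n \<in> borel_measurable (lebesgue_on \<Omega>)"
    "lam_gradient blk k \<alpha> (\<phi> n) \<in> borel_measurable (lebesgue_on \<Omega>)" for n
    using has_lam_gradient_C01[OF \<phi>[of n] assms(1), of blk k \<alpha> p] by (auto simp: has_lam_gradient_def)
  have p_pos: "0 < p"
    using p by simp
  have \<Omega>: "\<Omega> \<in> sets lebesgue"
    using assms(1) by auto
  have w: "?w \<in> borel_measurable (lebesgue_on K)" for K
    by (intro measurable_restrict_space1 measurable_completion) measurable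
  let ?E = "\<lambda>n. \<integral>\<^sup>+x. ennreal (norm (lam_gradient blk k \<alpha> (\<phi> n) x) powr p) \<partial>lebesgue_on \<Omega>"
  have limsup: "limsup ?E \<le> (\<integral>\<^sup>+x. ennreal (norm (G x) powr p) \<partial>lebesgue_on \<Omega>)"
    using p meas grad by (intro limsup_nn_integral_norm_powr_le Lp_norm_tendsto_0D) auto
  have "(\<integral>\<^sup>+x. ennreal (\<bar>u x\<bar> powr p) * ?w x \<partial>lebesgue_on K)
      \<le> (\<integral>\<^sup>+x. ennreal (norm (G x) powr p) \<partial>lebesgue_on \<Omega>)"
    if K: "compact K" "K \<subseteq> \<Omega>" for K
  proof -
    have "K \<in> sets lebesgue"
      using K(1) by (auto intro: fmeasurableD lmeasurable_compact)
    have sub: "f \<in> borel_measurable (lebesgue_on K)" if "f \<in> borel_measurable (lebesgue_on \<Omega>)" for f :: "real ^ 'n \<Rightarrow> real"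
      using that K(2) by (rule measurable_restrict_mono)
    obtain r :: "nat \<Rightarrow> nat" where r: "strict_mono r"
      and "(\<integral>\<^sup>+x. ennreal (\<bar>u x\<bar> powr p) * ?w x \<partial>lebesgue_on K)
        \<le> liminf (\<lambda>n. \<integral>\<^sup>+x. ennreal (\<bar>\<phi> (r n) x\<bar> powr p) * ?w x \<partial>lebesgue_on K)"
      by (rule nn_integral_powr_weighted_le_liminf_subseq[of p \<phi> "lebesgue_on K" u ?w,
            OF p_pos sub[OF meas(1)] sub[OF u] w L1[OF K]])
    note this(2)
    also have "liminf (\<lambda>n. \<integral>\<^sup>+x. ennreal (\<bar>\<phi> (r n) x\<bar> powr p) * ?w x \<partial>lebesgue_on K) \<le> liminf (?E \<circ> r)"
      unfolding o_def
      by (intro Liminf_mono always_eventually allI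
          hardy_inequality_C01_lam_gradient[OF \<phi> p lam \<Omega> \<open>K \<in> sets lebesgue\<close>])
    \<comment> \<open>The subsequence depends on K; passing to the upper limit of the whole sequence
      removes this dependence.\<close>
    also have "\<dots> \<le> limsup (?E \<circ> r)"
      by (rule Liminf_le_Limsup) simp
    also have "\<dots> \<le> limsup ?E"
      by (rule limsup_subseq_mono[OF r])
    also note limsup
    finally show ?thesis .
  qed
  moreover have "(\<lambda>x. ennreal (\<bar>u x\<bar> powr p) * ?w x) \<in> borel_measurable (lebesgue_on \<Omega>)"
    by (intro borel_measurable_times_ennreal w) measurable
  ultimately have "(\<integral>\<^sup>+x. ennreal (\<bar>u x\<bar> powr p) * ?w x \<partial>lebesgue_on \<Omega>)
      \<le> (\<integral>\<^sup>+x. ennreal (norm (G x) powr p) \<partial>lebesgue_on \<Omega>)"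
    by (intro nn_integral_lebesgue_on_open_le[OF assms(1)])
  also have "(\<integral>\<^sup>+x. ennreal (\<bar>u x\<bar> powr p) * ?w x \<partial>lebesgue_on \<Omega>)
      = (\<integral>\<^sup>+x. ?C * (ennreal (\<bar>u x\<bar> powr p) / ?h x) \<partial>lebesgue_on \<Omega>)"
    by (intro nn_integral_cong) (simp add: divide_ennreal_def mult_ac)
  also have "\<dots> = ?C * (\<integral>\<^sup>+x. ennreal (\<bar>u x\<bar> powr p) / ?h x \<partial>lebesgue_on \<Omega>)"
  proof (intro nn_integral_cmult borel_measurable_divide_ennreal)
    show "?h \<in> borel_measurable (lebesgue_on \<Omega>)"
      by (intro measurable_restrict_space1 measurable_completion) measurable
  qed measurable
  finally show ?thesis .
qed

theorem theorem3:
  fixes blk :: "'n::finite \<Rightarrow> nat"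
    and k :: nat
    and \<alpha> :: "nat \<Rightarrow> nat \<Rightarrow> real"
    and \<Omega> :: "(real ^ 'n) set"
    and p :: real
    and nrm :: "real ^ 'n \<Rightarrow> real"
    and u :: "real ^ 'n \<Rightarrow> real"
    and G :: "real ^ 'n \<Rightarrow> real ^ 'n"
  assumes blocks: "range blk = {1..k}"
    and alpha_nonneg: "\<And>i j. 1 \<le> j \<Longrightarrow> j < i \<Longrightarrow> i \<le> k \<Longrightarrow> 0 \<le> \<alpha> i j"
    and alpha_zero: "\<And>i j. 1 \<le> i \<Longrightarrow> i \<le> j \<Longrightarrow> j \<le> k \<Longrightarrow> \<alpha> i j = 0"
    and lam_different: "inj_on (lam blk k \<alpha>) {1..k}"
    and dim: "3 \<le> CARD('n)"
    and Omega: "open \<Omega>"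
    and nrm: "nrm = hnorm blk k \<alpha> \<or> nrm = hnorm_weighted blk k \<alpha>"
    and p: "1 < p" "p < real (bdim blk 1)"
    and u: "u \<in> W0 blk k \<alpha> p \<Omega>"
    and G: "has_lam_gradient blk k \<alpha> p \<Omega> u G"
  shows "ennreal (((real (bdim blk 1) - p) / p) powr p) *
           (\<integral>\<^sup>+x. ennreal (\<bar>u x\<bar> powr p) / ennreal (norm (bcomp blk 1 x) powr p) \<partial>lebesgue_on \<Omega>)
         \<le> (\<integral>\<^sup>+x. ennreal (norm (G x) powr p) \<partial>lebesgue_on \<Omega>)
       \<and>
         ennreal (((real (bdim blk 1) - p) / p) powr p) *
           (\<integral>\<^sup>+x. ennreal (\<bar>u x\<bar> powr p) / ennreal (nrm x powr p) \<partial>lebesgue_on \<Omega>)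
         \<le> (\<integral>\<^sup>+x. ennreal (norm (G x) powr p) \<partial>lebesgue_on \<Omega>)"
proof -
  let ?C = "ennreal (((real (bdim blk 1) - p) / p) powr p)"
  \<comment> \<open>The index type is nonempty, so the range of \<open>blk\<close> is nonempty and k
    = 0 is impossible.\<close>
  have k: "1 \<le> k"
    using blocks by (cases k) auto
  have lam: "lam blk k \<alpha> 1 x = 1" for x
    using alpha_zero by (intro lam_1) auto
  have first: "?C * (\<integral>\<^sup>+x. ennreal (\<bar>u x\<bar> powr p) / ennreal (norm (bcomp blk 1 x) powr p) \<partial>lebesgue_on \<Omega>)
      \<le> (\<integral>\<^sup>+x. ennreal (norm (G x) powr p) \<partial>lebesgue_on \<Omega>)"
    by (rule hardy_inequality_has_lam_gradient[OF Omega p lam G])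
  have sigma: "1 \<le> sigma \<alpha> i" if "i \<le> k" for i
    using alpha_nonneg that by (rule sigma_ge_1)
  have "norm (bcomp blk 1 x) \<le> nrm x" for x
    using nrm first_le_homogeneous_norm[OF sigma k, of "\<lambda>j. norm (bcomp blk j x)"]
      first_le_homogeneous_norm[OF sigma k, of "\<lambda>j. sigma \<alpha> j * norm (bcomp blk j x)"]
    by (auto simp: hnorm_def hnorm_weighted_def sigma_1[unfolded One_nat_def])
  \<comment> \<open>This holds at every point: where x^(1) = 0 the right quotient is infinite if u x
    is nonzero, and both quotients are 0 if u x = 0.\<close>
  then have "ennreal (\<bar>u x\<bar> powr p) / ennreal (nrm x powr p)
      \<le> ennreal (\<bar>u x\<bar> powr p) / ennreal (norm (bcomp blk 1 x) powr p)" for x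
    unfolding divide_ennreal_def using p
    by (intro mult_left_mono inverse_ennreal_antimono powr_mono2) auto
  then have "?C * (\<integral>\<^sup>+x. ennreal (\<bar>u x\<bar> powr p) / ennreal (nrm x powr p) \<partial>lebesgue_on \<Omega>)
      \<le> ?C * (\<integral>\<^sup>+x. ennreal (\<bar>u x\<bar> powr p) / ennreal (norm (bcomp blk 1 x) powr p) \<partial>lebesgue_on \<Omega>)"
    by (intro mult_left_mono nn_integral_mono) auto
  with first show ?thesis
    by (blast intro: order_trans)
qed

end
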